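(* For every integer $n\ge1$ and every digraph $G$ on $n$ vertices, $$D_0(G)\ge\log^*n-\log^*\log^*n-1.$$
   Context: A digraph is a finite non-empty set of vertices with a binary arc relation on it (loops allowed). First order sentences about digraphs use variables ranging over vertices, the relations $=$ and $\mapsto$ ($x\mapsto y$ means $(x,y)$ is an arc), quantifiers $\forall,\exists$, connectives $\vee,\wedge,\neg$ and parentheses. A sentence $\Phi$ defines a digraph $G$ if it is true on $G$ and false on every digraph not isomorphic to $G$. The quantifier depth is the maximum number of nested quantifiers. A sentence is $0$-alternating if negations occur only directly in front of atomic formulas and no sequence of nested quantifiers contains an occurrence of $\forall\exists$ or $\exists\forall$. $D_0(G)$ is the minimum quantifier depth of a $0$-alternating sentence defining $G$. $\log^*n$ is the minimum number of iterations of the binary logarithm needed to bring $n$ to $1$ or below. *)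

theory Defs
  imports Complex_Main "HOL-Library.Sublist" "Graph_Theory.Graph_Theory"
begin

definition nonempty_fin_digraph :: "'v pair_pre_digraph \<Rightarrow> bool" where
  "nonempty_fin_digraph G \<longleftrightarrow> pair_fin_digraph G \<and> pverts G \<noteq> {}"

datatype fo_formula =
    Eq nat nat
  | Arc nat nat
  | Neg fo_formula
  | Conj fo_formula fo_formula
  | Disj fo_formula fo_formula
  | All nat fo_formula
  | Ex nat fo_formula

primrec free_vars :: "fo_formula \<Rightarrow> nat set" where
  "free_vars (Eq x y) = {x, y}"
| "free_vars (Arc x y) = {x, y}"
| "free_vars (Neg \<phi>) = free_vars \<phi>"
| "free_vars (Conj \<phi> \<psi>) = free_vars \<phi> \<union> free_vars \<psi>"
| "free_vars (Disj \<phi> \<psi>) = free_vars \<phi> \<union> free_vars \<psi>"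
| "free_vars (All x \<phi>) = free_vars \<phi> - {x}"
| "free_vars (Ex x \<phi>) = free_vars \<phi> - {x}"

definition sentence :: "fo_formula \<Rightarrow> bool" where
  "sentence \<phi> \<longleftrightarrow> free_vars \<phi> = {}"

primrec sat :: "'v pair_pre_digraph \<Rightarrow> (nat \<Rightarrow> 'v) \<Rightarrow> fo_formula \<Rightarrow> bool" where
  "sat G e (Eq x y) \<longleftrightarrow> e x = e y"
| "sat G e (Arc x y) \<longleftrightarrow> (e x, e y) \<in> parcs G"
| "sat G e (Neg \<phi>) \<longleftrightarrow> \<not> sat G e \<phi>"
| "sat G e (Conj \<phi> \<psi>) \<longleftrightarrow> sat G e \<phi> \<and> sat G e \<psi>"
| "sat G e (Disj \<phi> \<psi>) \<longleftrightarrow> sat G e \<phi> \<or> sat G e \<psi>"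
| "sat G e (All x \<phi>) \<longleftrightarrow> (\<forall>v \<in> pverts G. sat G (e(x := v)) \<phi>)"
| "sat G e (Ex x \<phi>) \<longleftrightarrow> (\<exists>v \<in> pverts G. sat G (e(x := v)) \<phi>)"

text \<open>Only applied to sentences, whose value does not depend on the assignment.\<close>

definition true_on :: "fo_formula \<Rightarrow> 'v pair_pre_digraph \<Rightarrow> bool" where
  "true_on \<phi> G \<longleftrightarrow> (\<forall>e. sat G e \<phi>)"

text \<open>Every finite digraph is isomorphic to one whose vertices are natural numbers, so
  letting \<open>H\<close> range over vertex sets in \<^typ>\<open>nat\<close> covers all digraphs up to isomorphism.\<close>

definition defines_digraph :: "fo_formula \<Rightarrow> 'v pair_pre_digraph \<Rightarrow> bool" where
  "defines_digraph \<phi> G \<longleftrightarrow> sentence \<phi> \<and> true_on \<phi> G \<and>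
     (\<forall>H :: nat pair_pre_digraph. nonempty_fin_digraph H \<and>
        \<not> digraph_iso (with_proj G) (with_proj H) \<longrightarrow> \<not> true_on \<phi> H)"

primrec quantifier_depth :: "fo_formula \<Rightarrow> nat" where
  "quantifier_depth (Eq x y) = 0"
| "quantifier_depth (Arc x y) = 0"
| "quantifier_depth (Neg \<phi>) = quantifier_depth \<phi>"
| "quantifier_depth (Conj \<phi> \<psi>) = max (quantifier_depth \<phi>) (quantifier_depth \<psi>)"
| "quantifier_depth (Disj \<phi> \<psi>) = max (quantifier_depth \<phi>) (quantifier_depth \<psi>)"
| "quantifier_depth (All x \<phi>) = Suc (quantifier_depth \<phi>)"
| "quantifier_depth (Ex x \<phi>) = Suc (quantifier_depth \<phi>)"

fun negations_at_atoms :: "fo_formula \<Rightarrow> bool" where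
  "negations_at_atoms (Eq x y) \<longleftrightarrow> True"
| "negations_at_atoms (Arc x y) \<longleftrightarrow> True"
| "negations_at_atoms (Neg (Eq x y)) \<longleftrightarrow> True"
| "negations_at_atoms (Neg (Arc x y)) \<longleftrightarrow> True"
| "negations_at_atoms (Neg _) \<longleftrightarrow> False"
| "negations_at_atoms (Conj \<phi> \<psi>) \<longleftrightarrow> negations_at_atoms \<phi> \<and> negations_at_atoms \<psi>"
| "negations_at_atoms (Disj \<phi> \<psi>) \<longleftrightarrow> negations_at_atoms \<phi> \<and> negations_at_atoms \<psi>"
| "negations_at_atoms (All x \<phi>) \<longleftrightarrow> negations_at_atoms \<phi>"
| "negations_at_atoms (Ex x \<phi>) \<longleftrightarrow> negations_at_atoms \<phi>"

datatype quantifier = Forall | Exists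

text \<open>The quantifiers met on the paths from the root of the syntax tree to its leaves.\<close>

primrec nested_quantifiers :: "fo_formula \<Rightarrow> quantifier list set" where
  "nested_quantifiers (Eq x y) = {[]}"
| "nested_quantifiers (Arc x y) = {[]}"
| "nested_quantifiers (Neg \<phi>) = nested_quantifiers \<phi>"
| "nested_quantifiers (Conj \<phi> \<psi>) = nested_quantifiers \<phi> \<union> nested_quantifiers \<psi>"
| "nested_quantifiers (Disj \<phi> \<psi>) = nested_quantifiers \<phi> \<union> nested_quantifiers \<psi>"
| "nested_quantifiers (All x \<phi>) = (#) Forall ` nested_quantifiers \<phi>"
| "nested_quantifiers (Ex x \<phi>) = (#) Exists ` nested_quantifiers \<phi>"

definition zero_alternating :: "fo_formula \<Rightarrow> bool" where
  "zero_alternating \<phi> \<longleftrightarrow> negations_at_atoms \<phi> \<and>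
     (\<forall>qs \<in> nested_quantifiers \<phi>.
        \<not> sublist [Forall, Exists] qs \<and> \<not> sublist [Exists, Forall] qs)"

definition D0 :: "'v pair_pre_digraph \<Rightarrow> nat" where
  "D0 G = (LEAST d. \<exists>\<phi>. zero_alternating \<phi> \<and> defines_digraph \<phi> G \<and> quantifier_depth \<phi> = d)"

text \<open>All iterates before the least one that is at most 1 exceed 1, so the values
  of \<^const>\<open>log\<close> at nonpositive arguments play no role.\<close>

definition log_star :: "real \<Rightarrow> nat" where
  "log_star x = (LEAST k. (log 2 ^^ k) x \<le> 1)"

end

theory Submission
  imports Defs "HOL-Library.FSet"
begin

text \<open>A 0-alternating sentence is a monotone combination of purely existential and purely
  universal sentences. Universal sentences true on \<open>G\<close> stay true on induced subgraphs. For the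
  existential ones of depth at most \<open>d\<close>, it suffices to keep one representative of every type that
  vertices realise over the representatives chosen before, in a tree of height \<open>d\<close>. The resulting
  induced subgraph satisfies every such sentence true on \<open>G\<close>, so a \<open>G\<close> defined by one of them
  has no more vertices than that tree. Each level of the tree costs one exponential, starting from
  the at most \<open>2^(2d-1)\<close> ways to attach a last vertex to \<open>d - 1\<close> others, and the tower of height
  \<open>d + 1 + log* d\<close> dominates the total.\<close>

section \<open>Towers and the iterated logarithm\<close>

text \<open>The start value 1 matches the threshold in \<open>log_star\<close>:
  \<open>tower h\<close> is the largest number whose iterated logarithm is \<open>h\<close>.\<close>

primrec tower :: "nat \<Rightarrow> nat" where
  "tower 0 = 1"
| "tower (Suc h) = 2 ^ tower h"

lemma tower_mono: "h \<le> k \<Longrightarrow> tower h \<le> tower k"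
  by (rule lift_Suc_mono_le) (auto intro: less_imp_le)

lemma le_tower: "n \<le> tower n"
proof (induction n)
  case (Suc n)
  show ?case by (simp add: Suc_le_eq le_less_trans[OF Suc less_exp])
qed simp

text \<open>Each logarithm removes one level of the tower. Some \<open>k \<le> h\<close> is
  produced, not \<open>h\<close> itself, because the iteration stops at the first value up to 1, so
  \<open>log\<close> is applied only to numbers above 1.\<close>

lemma ex_iterated_log_le_1:
  fixes x :: real
  assumes "x \<le> tower h"
  shows "\<exists>k\<le>h. (log 2 ^^ k) x \<le> 1"
  using assms
proof (induction h arbitrary: x)
  case (Suc h)
  show ?case
  proof (cases "x \<le> 1")
    case False
    with Suc.prems have "log 2 x \<le> tower h"
      by (simp add: log_le_iff powr_realpow)
    with Suc.IH obtain k where "k \<le> h" "(log 2 ^^ k) (log 2 x) \<le> 1" by blast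
    then show ?thesis
      by (intro exI[of _ "Suc k"]) (simp add: funpow_Suc_right del: funpow.simps)
  qed (auto intro!: exI[of _ 0])
qed auto

lemma log_star_le_if_le_tower:
  assumes "x \<le> real (tower h)"
  shows "log_star x \<le> h"
proof -
  obtain k where "k \<le> h" "(log 2 ^^ k) x \<le> 1" using ex_iterated_log_le_1[OF assms] by blast
  then show ?thesis unfolding log_star_def using Least_le[of "\<lambda>k. (log 2 ^^ k) x \<le> 1" k] by linarith
qed

text \<open>Each exponentiation undoes one logarithm; this is legitimate because all earlier
  iterates exceed 1.\<close>

lemma le_tower_if_iterated_log_le:
  fixes x :: real
  assumes "(log 2 ^^ k) x \<le> 1" and "\<And>j. j < k \<Longrightarrow> (log 2 ^^ j) x > 1"
  shows "x \<le> tower k"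
  using assms
proof (induction k arbitrary: x)
  case (Suc k)
  have "x > 1" using Suc.prems(2)[of 0] by simp
  have "log 2 x \<le> tower k"
  proof (rule Suc.IH)
    show "(log 2 ^^ k) (log 2 x) \<le> 1"
      using Suc.prems(1) by (simp add: funpow_Suc_right del: funpow.simps)
    show "(log 2 ^^ j) (log 2 x) > 1" if "j < k" for j
      using Suc.prems(2)[of "Suc j"] that by (simp add: funpow_Suc_right del: funpow.simps)
  qed
  with \<open>x > 1\<close> show ?case by (simp add: log_le_iff powr_realpow)
qed simp

lemma le_tower_log_star: "m \<le> tower (log_star (real m))"
proof -
  have "\<exists>k. (log 2 ^^ k) (real m) \<le> 1"
    using ex_iterated_log_le_1[of "real m" m] le_tower[of m] by auto
  then have "(log 2 ^^ log_star (real m)) (real m) \<le> 1"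
    unfolding log_star_def by (rule LeastI_ex)
  moreover have "(log 2 ^^ j) (real m) > 1" if "j < log_star (real m)" for j
    using not_less_Least[OF that[unfolded log_star_def]] by simp
  ultimately have "real m \<le> real (tower (log_star (real m)))" by (rule le_tower_if_iterated_log_le)
  then show ?thesis by simp
qed

lemma log_star_mono: "m \<le> n \<Longrightarrow> log_star (real m) \<le> log_star (real n)" for m n :: nat
  by (rule log_star_le_if_le_tower) (use le_tower_log_star[of n] in linarith)

section \<open>Numerical bounds\<close>

text \<open>A vertex has \<^term>\<open>2 * s + 1\<close> possible arcs to itself and to and from \<open>s\<close> others.\<close>

primrec type_bound :: "nat \<Rightarrow> nat \<Rightarrow> nat" where
  "type_bound 0 s = 2 ^ (2 * s + 1)"
| "type_bound (Suc k) s = 2 ^ (2 * s + 1) * 2 ^ type_bound k (Suc s)"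

text \<open>Counts the nodes of the tree of representatives: one for each type over \<open>s\<close>
  vertices, each followed by a tree over the tuple extended by it.\<close>

primrec witness_bound :: "nat \<Rightarrow> nat \<Rightarrow> nat" where
  "witness_bound 0 s = 0"
| "witness_bound (Suc k) s = type_bound k s * Suc (witness_bound k (Suc s))"

lemma type_bound_le_witness_bound: "type_bound k s \<le> witness_bound (Suc k) s"
  by simp

text \<open>With \<open>w\<close> the bound one level below, both the exponent
  \<open>type_bound k (Suc s)\<close> and \<open>log 2 (Suc w)\<close> are at most \<open>w\<close>.
  Hence each level costs a single exponential, and the types disappear from the recursion.\<close>

lemma witness_bound_step:
  "witness_bound (Suc (Suc k)) s \<le> 2 ^ (2 * s + 1 + 2 * witness_bound (Suc k) (Suc s))"
proof -
  let ?w = "witness_bound (Suc k) (Suc s)"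
  have "witness_bound (Suc (Suc k)) s = 2 ^ (2 * s + 1) * 2 ^ type_bound k (Suc s) * Suc ?w"
    by simp
  also have "\<dots> \<le> 2 ^ (2 * s + 1) * 2 ^ ?w * 2 ^ ?w"
    using type_bound_le_witness_bound[of k "Suc s"] Suc_leI[OF less_exp[of ?w]]
    by (intro mult_mono power_increasing) (auto simp del: witness_bound.simps)
  also have "\<dots> = 2 ^ (2 * s + 1 + 2 * ?w)"
    by (simp only: power_add mult_2 mult.assoc)
  finally show ?thesis .
qed

text \<open>The summand \<^term>\<open>2 * m + 6\<close> on the left absorbs the factors lost in each application of
  the recursive bound, so that the iterated exponential can start at a fixed value.\<close>

lemma witness_bound_le_iterated_exp:
  assumes "s + k = m"
  shows "2 * witness_bound (Suc k) s + 2 * m + 6 \<le> ((^) 2 ^^ k) (2 ^ (2 * m + 2) + 2 * m + 6)"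
  using assms
proof (induction k arbitrary: s)
  case 0
  then show ?case by simp
next
  case (Suc k)
  let ?w = "witness_bound (Suc k) (Suc s)"
  let ?E = "((^) 2 ^^ k) (2 ^ (2 * m + 2) + 2 * m + 6) :: nat"
  have IH: "2 * ?w + 2 * m + 6 \<le> ?E" using Suc by simp
  \<comment> \<open>Both summands of the goal will be bounded by the same power of 2, so that adding
    them raises the exponent only by one, to a value that \<open>IH\<close> covers.\<close>
  have m: "2 * m + 6 \<le> 2 ^ (2 * m + 3)"
    by (induction m) (auto simp: power_add)
  have "2 * witness_bound (Suc (Suc k)) s + 2 * m + 6
      \<le> 2 * 2 ^ (2 * s + 1 + 2 * ?w) + 2 ^ (2 * m + 3)"
    using witness_bound_step[of k s] m by linarith
  also have "\<dots> \<le> 2 ^ (2 * m + 3 + 2 * ?w) + 2 ^ (2 * m + 3 + 2 * ?w)"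
  proof -
    have "(2::nat) * 2 ^ (2 * s + 1 + 2 * ?w) = 2 ^ (2 * s + 2 + 2 * ?w)" by simp
    also have "\<dots> \<le> 2 ^ (2 * m + 3 + 2 * ?w)"
      using Suc.prems by (intro power_increasing) auto
    moreover have "(2::nat) ^ (2 * m + 3) \<le> 2 ^ (2 * m + 3 + 2 * ?w)"
      by (intro power_increasing) auto
    ultimately show ?thesis by linarith
  qed
  also have "\<dots> = 2 ^ (2 * m + 4 + 2 * ?w)" by (simp add: power_add del: witness_bound.simps)
  also have "\<dots> \<le> 2 ^ ?E" using IH by (intro power_increasing) auto
  finally show ?case by simp
qed

lemma tower_add: "tower (k + h) = ((^) 2 ^^ k) (tower h)"
  by (induction k) auto

lemma iterated_exp_mono: "x \<le> y \<Longrightarrow> ((^) 2 ^^ k) x \<le> (((^) 2 ^^ k) y :: nat)"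
  by (induction k) auto

text \<open>For \<open>d \<ge> 3\<close> the iteration starts below
  \<open>2 ^ (2 * d + 1) \<le> 2 ^ 2 ^ d\<close>, which lies below the tower of height
  \<open>log_star d + 2\<close>; the other \<open>d - 1\<close> levels add one each.\<close>

lemma witness_bound_le_tower:
  assumes "d \<ge> 1"
  shows "witness_bound d 0 \<le> tower (d + 1 + log_star (real d))"
proof -
  \<comment> \<open>The estimate \<open>exp_lin\<close> fails for \<open>m < 2\<close>, so depths 1
    and 2 are evaluated directly.\<close>
  consider "d = 1" | "d = 2" | "d \<ge> 3" using assms by linarith
  then show ?thesis
  proof cases
    case 1
    then show ?thesis using tower_mono[of 2 "2 + log_star 1"] by (simp add: numeral_2_eq_2)
  next
    case 2
    \<comment> \<open>The bound for depth 2 is \<open>2 ^ 9 * 9 = 4608\<close>, which exceeds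
      \<open>tower 3 = 16\<close> and so needs height 4.\<close>
    have "log_star (real 2) \<noteq> 0" using le_tower_log_star[of 2] by (intro notI) simp
    then have le: "Suc (Suc (Suc (Suc 0))) \<le> d + 1 + log_star (real d)" using 2 by simp
    have "witness_bound d 0 = witness_bound (Suc (Suc 0)) 0" by (simp only: 2 numeral_2_eq_2)
    also have "\<dots> \<le> tower (Suc (Suc (Suc (Suc 0))))" by simp
    also have "\<dots> \<le> tower (d + 1 + log_star (real d))" by (rule tower_mono[OF le])
    finally show ?thesis .
  next
    case 3
    then obtain m where m: "d = Suc m" "m \<ge> 2" by (cases d) auto
    have exp_lin: "2 * m + 3 \<le> 2 ^ Suc m"
      using \<open>m \<ge> 2\<close> by (induction m rule: dec_induct) auto
    have "2 * m + 6 \<le> 2 ^ (2 * m + 2)"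
      using \<open>m \<ge> 2\<close> by (induction m rule: dec_induct) (auto simp: power_add)
    then have "2 ^ (2 * m + 2) + 2 * m + 6 \<le> (2::nat) ^ (2 * m + 3)"
      by (simp add: power_add)
    also have "\<dots> \<le> 2 ^ 2 ^ Suc m" using exp_lin by (intro power_increasing) auto
    also have "\<dots> \<le> 2 ^ 2 ^ tower (log_star (real d))"
      using le_tower_log_star[of d] m by (intro power_increasing) auto
    finally have y: "2 ^ (2 * m + 2) + 2 * m + 6 \<le> tower (Suc (Suc (log_star (real d))))"
      by (simp only: tower.simps)
    have "witness_bound d 0 \<le> ((^) 2 ^^ m) (2 ^ (2 * m + 2) + 2 * m + 6)"
      unfolding m(1) using witness_bound_le_iterated_exp[of 0 m m, OF add_0] by linarith
    also have "\<dots> \<le> ((^) 2 ^^ m) (tower (Suc (Suc (log_star (real d)))))"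
      by (rule iterated_exp_mono[OF y])
    also have "\<dots> = tower (d + 1 + log_star (real d))"
      unfolding tower_add[symmetric] m(1) by (simp del: tower.simps)
    finally show ?thesis .
  qed
qed

section \<open>Types of vertices over a tuple\<close>

text \<open>An Ehrenfeucht-Fraisse type as a finite tree: how a vertex attaches to the tuple, and
  which types occur once it is appended. No vertices are mentioned, so types over different tuples
  can be compared.\<close>

datatype ext_type = Ext_Type "bool list" "ext_type fset"

definition arc_pattern :: "'v pair_pre_digraph \<Rightarrow> 'v list \<Rightarrow> 'v \<Rightarrow> bool list" where
  "arc_pattern G us v = ((v, v) \<in> parcs G) #
     map (\<lambda>u. (u, v) \<in> parcs G) us @ map (\<lambda>u. (v, u) \<in> parcs G) us"

text \<open>A type records only the arcs between a new vertex and \<open>us\<close>, not those inside \<open>us\<close>, so the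
  number of types depends on the length of \<open>us\<close> alone.\<close>

primrec ext_types :: "'v pair_pre_digraph \<Rightarrow> nat \<Rightarrow> 'v list \<Rightarrow> ext_type fset" where
  "ext_types G 0 us = {||}"
| "ext_types G (Suc k) us =
     (\<lambda>v. Ext_Type (arc_pattern G us v) (ext_types G k (v # us))) |`| Abs_fset (pverts G - set us)"

lemma fset_ext_types_Suc:
  assumes "finite (pverts G)"
  shows "fset (ext_types G (Suc k) us) =
    (\<lambda>v. Ext_Type (arc_pattern G us v) (ext_types G k (v # us))) ` (pverts G - set us)"
  using assms by (simp add: Abs_fset_inverse)

text \<open>The forth step of a back-and-forth game: a new vertex over one tuple is answered over
  the other.\<close>

lemma ext_types_SucE:
  assumes "finite (pverts G)" and "ext_types G (Suc k) us = ext_types G (Suc k) ws"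
    and "v \<in> pverts G - set us"
  obtains w where "w \<in> pverts G - set ws" "arc_pattern G us v = arc_pattern G ws w"
    "ext_types G k (v # us) = ext_types G k (w # ws)"
proof -
  have "Ext_Type (arc_pattern G us v) (ext_types G k (v # us)) \<in> fset (ext_types G (Suc k) ws)"
    using assms(3) unfolding assms(2)[symmetric] fset_ext_types_Suc[OF assms(1)] by blast
  then show thesis using that unfolding fset_ext_types_Suc[OF assms(1)] by auto
qed

lemma ext_types_Suc_eqI:
  assumes fin: "finite (pverts G)"
    and 1: "\<And>v. v \<in> pverts G - set us \<Longrightarrow> \<exists>w \<in> pverts G - set ws.
      arc_pattern G us v = arc_pattern G ws w \<and> ext_types G k (v # us) = ext_types G k (w # ws)"
    and 2: "\<And>w. w \<in> pverts G - set ws \<Longrightarrow> \<exists>v \<in> pverts G - set us.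
      arc_pattern G us v = arc_pattern G ws w \<and> ext_types G k (v # us) = ext_types G k (w # ws)"
  shows "ext_types G (Suc k) us = ext_types G (Suc k) ws"
  unfolding fset_inject[symmetric] fset_ext_types_Suc[OF fin] using 1 2 by (auto simp: image_iff) metis+

text \<open>Types of depth \<open>Suc k\<close> do not literally contain those of depth
  \<open>k\<close>, so back-and-forth is used to truncate them. This serves quantifiers that pick a
  vertex already in the tuple: the depth drops while the tuple stays.\<close>

lemma ext_types_eq_mono:
  assumes "finite (pverts G)" and "ext_types G (Suc k) us = ext_types G (Suc k) ws"
  shows "ext_types G k us = ext_types G k ws"
  using assms(2)
proof (induction k arbitrary: us ws)
  case (Suc k)
  show ?case
  proof (rule ext_types_Suc_eqI[OF assms(1)])
    fix v assume "v \<in> pverts G - set us"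
    from ext_types_SucE[OF assms(1) Suc.prems this]
    show "\<exists>w \<in> pverts G - set ws.
      arc_pattern G us v = arc_pattern G ws w \<and> ext_types G k (v # us) = ext_types G k (w # ws)"
      using Suc.IH by metis
  next
    fix w assume "w \<in> pverts G - set ws"
    from ext_types_SucE[OF assms(1) Suc.prems[symmetric] this]
    show "\<exists>v \<in> pverts G - set us.
      arc_pattern G us v = arc_pattern G ws w \<and> ext_types G k (v # us) = ext_types G k (w # ws)"
      using Suc.IH by metis
  qed
qed simp

text \<open>A universe of types independent of the digraph. The index is shifted: the members of
  \<open>ext_types G (Suc k) us\<close> lie in level \<open>k\<close>, since
  \<open>ext_types G 0 us\<close> is empty.\<close>

primrec ext_type_space :: "nat \<Rightarrow> nat \<Rightarrow> ext_type set" where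
  "ext_type_space 0 s = (\<lambda>b. Ext_Type b {||}) ` {b. length b = 2 * s + 1}"
| "ext_type_space (Suc k) s = (\<lambda>(b, X). Ext_Type b X) `
     ({b. length b = 2 * s + 1} \<times> {X. fset X \<subseteq> ext_type_space k (Suc s)})"

lemma card_bool_lists: "card {b :: bool list. length b = n} = 2 ^ n"
  using card_lists_length_eq[of "UNIV :: bool set" n] by simp

lemma finite_bool_lists: "finite {b :: bool list. length b = n}"
  using finite_lists_length_eq[of "UNIV :: bool set" n] by simp

lemma fset_image_Collect_subset: "finite S \<Longrightarrow> fset ` {X. fset X \<subseteq> S} = Pow S"
  by (auto simp: image_iff) (metis Abs_fset_inverse mem_Collect_eq finite_subset)

lemma finite_fsets_subset: "finite S \<Longrightarrow> finite {X. fset X \<subseteq> S}"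
  by (rule finite_imageD[of fset]) (auto simp: fset_image_Collect_subset inj_on_def fset_inject)

lemma card_fsets_subset: "finite S \<Longrightarrow> card {X. fset X \<subseteq> S} = 2 ^ card S"
  using card_image[of fset "{X. fset X \<subseteq> S}"]
  by (simp add: fset_image_Collect_subset inj_on_def fset_inject card_Pow)

lemma ext_type_space_card:
  "finite (ext_type_space k s) \<and> card (ext_type_space k s) \<le> type_bound k s"
proof (induction k arbitrary: s)
  case 0
  show ?case
    using card_image_le[OF finite_bool_lists[of "2 * s + 1"], of "\<lambda>b. Ext_Type b {||}"]
      finite_bool_lists[of "2 * s + 1"]
    unfolding card_bool_lists by simp
next
  case (Suc k)
  let ?S = "ext_type_space k (Suc s)"
  let ?P = "{b :: bool list. length b = 2 * s + 1} \<times> {X. fset X \<subseteq> ?S}"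
  have S: "finite ?S" "card ?S \<le> type_bound k (Suc s)" using Suc.IH by auto
  then have fin: "finite ?P" using finite_bool_lists finite_fsets_subset by blast
  have "card ?P \<le> 2 ^ (2 * s + 1) * 2 ^ type_bound k (Suc s)"
    unfolding card_cartesian_product card_bool_lists card_fsets_subset[OF S(1)]
    using S(2) by (intro mult_mono power_increasing) auto
  with card_image_le[OF fin, of "\<lambda>(b, X). Ext_Type b X"] fin show ?case
    by (simp only: ext_type_space.simps type_bound.simps) auto
qed

lemma length_arc_pattern [simp]: "length (arc_pattern G us v) = 2 * length us + 1"
  by (simp add: arc_pattern_def)

lemma ext_types_in_space:
  assumes "finite (pverts G)"
  shows "fset (ext_types G (Suc k) us) \<subseteq> ext_type_space k (length us)"
proof (induction k arbitrary: us)
  case 0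
  show ?case unfolding fset_ext_types_Suc[OF assms] by auto
next
  case (Suc k)
  show ?case
  proof
    fix t assume "t \<in> fset (ext_types G (Suc (Suc k)) us)"
    then obtain v where t: "t = Ext_Type (arc_pattern G us v) (ext_types G (Suc k) (v # us))"
      unfolding fset_ext_types_Suc[OF assms] by blast
    show "t \<in> ext_type_space (Suc k) (length us)"
      using Suc.IH[of "v # us"] unfolding t
      by (auto simp del: ext_types.simps intro!: image_eqI[where x = "(arc_pattern G us v, ext_types G (Suc k) (v # us))"])
  qed
qed

lemma card_ext_types:
  assumes "finite (pverts G)"
  shows "card (fset (ext_types G (Suc k) us)) \<le> type_bound k (length us)"
  using card_mono[OF _ ext_types_in_space[OF assms]] ext_type_space_card le_trans by blast

text \<open>Only vertices outside \<open>us\<close> need representatives: quantifying over a member of \<open>us\<close> leaves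
  the tuple unchanged and merely lowers the remaining depth.\<close>

primrec witnesses :: "'v pair_pre_digraph \<Rightarrow> nat \<Rightarrow> 'v list \<Rightarrow> 'v set \<Rightarrow> bool" where
  "witnesses G 0 us C \<longleftrightarrow> True"
| "witnesses G (Suc k) us C \<longleftrightarrow> (\<forall>v \<in> pverts G - set us. \<exists>w \<in> C - set us.
     arc_pattern G us v = arc_pattern G us w \<and> ext_types G k (v # us) = ext_types G k (w # us) \<and>
     witnesses G k (w # us) C)"

lemma witnesses_superset: "witnesses G k us C \<Longrightarrow> C \<subseteq> D \<Longrightarrow> witnesses G k us D"
proof (induction k arbitrary: us)
  case (Suc k)
  then show ?case by simp (meson DiffD1 DiffD2 DiffI subsetD)
qed simp

text \<open>The same representatives serve; only their types are truncated.\<close>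

lemma witnesses_depth_mono:
  assumes "finite (pverts G)" and "witnesses G (Suc k) us C"
  shows "witnesses G k us C"
  using assms(2)
proof (induction k arbitrary: us)
  case (Suc k)
  show ?case
    unfolding witnesses.simps
  proof
    fix v assume "v \<in> pverts G - set us"
    with Suc.prems obtain w where "w \<in> C - set us" "arc_pattern G us v = arc_pattern G us w"
      "ext_types G (Suc k) (v # us) = ext_types G (Suc k) (w # us)" "witnesses G (Suc k) (w # us) C"
      unfolding witnesses.simps(2)[of _ "Suc k"] by blast
    then show "\<exists>w \<in> C - set us. arc_pattern G us v = arc_pattern G us w \<and>
        ext_types G k (v # us) = ext_types G k (w # us) \<and> witnesses G k (w # us) C"
      using Suc.IH ext_types_eq_mono[OF assms(1)] by blast
  qed
qed simp

text \<open>One representative is chosen per type over \<open>us\<close>, together with a witness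
  set for the tuple extended by it. Enlarging a witness set is harmless, so the union serves all
  branches at once.\<close>

lemma ex_small_witnesses:
  assumes fin: "finite (pverts G)"
  shows "\<exists>C \<subseteq> pverts G. witnesses G k us C \<and> card C \<le> witness_bound k (length us)"
proof (induction k arbitrary: us)
  case 0
  show ?case by (intro exI[of _ "{}"]) simp
next
  case (Suc k)
  let ?t = "\<lambda>v. Ext_Type (arc_pattern G us v) (ext_types G k (v # us))"
  let ?V = "pverts G - set us"
  let ?T = "fset (ext_types G (Suc k) us)"
  have T: "?T = ?t ` ?V" by (rule fset_ext_types_Suc[OF fin])
  define rep where "rep = inv_into ?V ?t"
  have rep: "rep t \<in> ?V" "?t (rep t) = t" if "t \<in> ?T" for t
    using that inv_into_into[of t ?t ?V] f_inv_into_f[of t ?t ?V] unfolding T rep_def by auto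
  \<comment> \<open>The witness sets are chosen for all tuples simultaneously, so that they can be
    used under the union below.\<close>
  from Suc.IH obtain C where C: "\<And>ws. C ws \<subseteq> pverts G" "\<And>ws. witnesses G k ws (C ws)"
    "\<And>ws. card (C ws) \<le> witness_bound k (length ws)"
    by metis
  let ?D = "\<Union>t \<in> ?T. insert (rep t) (C (rep t # us))"
  have "?D \<subseteq> pverts G" using rep(1) C(1) by blast
  moreover have "witnesses G (Suc k) us ?D"
    unfolding witnesses.simps
  proof
    fix v assume "v \<in> ?V"
    then have t: "?t v \<in> ?T" unfolding T by blast
    have "witnesses G k (rep (?t v) # us) ?D"
      by (rule witnesses_superset[OF C(2)]) (use t in blast)
    moreover have "rep (?t v) \<in> ?D - set us" using t rep(1)[OF t] by blast
    moreover have "arc_pattern G us (rep (?t v)) = arc_pattern G us v"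
      "ext_types G k (rep (?t v) # us) = ext_types G k (v # us)"
      using rep(2)[OF t] by blast+
    ultimately show "\<exists>w \<in> ?D - set us. arc_pattern G us v = arc_pattern G us w \<and>
        ext_types G k (v # us) = ext_types G k (w # us) \<and> witnesses G k (w # us) ?D"
      by (intro bexI[of _ "rep (?t v)"] conjI) (simp_all only:)
  qed
  moreover have "card ?D \<le> witness_bound (Suc k) (length us)"
  proof -
    have "card ?D \<le> (\<Sum>t \<in> ?T. card (insert (rep t) (C (rep t # us))))"
      by (rule card_UN_le) simp
    also have "\<dots> \<le> (\<Sum>t \<in> ?T. Suc (witness_bound k (Suc (length us))))"
    proof (rule sum_mono)
      fix t
      show "card (insert (rep t) (C (rep t # us))) \<le> Suc (witness_bound k (Suc (length us)))"
        using C(3)[of "rep t # us"] card_insert_le_m1[of "Suc (witness_bound k (Suc (length us)))" "C (rep t # us)"]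
        by simp
    qed
    also have "\<dots> = card ?T * Suc (witness_bound k (Suc (length us)))" by simp
    also have "\<dots> \<le> type_bound k (length us) * Suc (witness_bound k (Suc (length us)))"
      by (rule mult_right_mono[OF card_ext_types[OF fin]]) simp
    finally show ?thesis by simp
  qed
  ultimately show ?case by blast
qed

section \<open>Preservation under induced subgraphs\<close>

text \<open>Distinctness of both tuples encodes preservation of equality: entries coincide exactly
  when their positions do.\<close>

definition partial_iso :: "'v pair_pre_digraph \<Rightarrow> 'v list \<Rightarrow> 'v list \<Rightarrow> bool" where
  "partial_iso G us ws \<longleftrightarrow> length us = length ws \<and> distinct us \<and> distinct ws \<and>
     (\<forall>i < length us. \<forall>j < length us. (us ! i, us ! j) \<in> parcs G \<longleftrightarrow> (ws ! i, ws ! j) \<in> parcs G)"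

text \<open>The arc pattern lists exactly the pairs that involve the new vertex; all others are
  old.\<close>

lemma partial_iso_Cons:
  assumes "partial_iso G us ws" and "v \<notin> set us" and "w \<notin> set ws"
    and "arc_pattern G us v = arc_pattern G ws w"
  shows "partial_iso G (v # us) (w # ws)"
proof -
  have len: "length us = length ws" using assms(1) by (simp add: partial_iso_def)
  have "(v, v) \<in> parcs G \<longleftrightarrow> (w, w) \<in> parcs G"
    and "\<forall>i < length us. (us ! i, v) \<in> parcs G \<longleftrightarrow> (ws ! i, w) \<in> parcs G"
    and "\<forall>i < length us. (v, us ! i) \<in> parcs G \<longleftrightarrow> (w, ws ! i) \<in> parcs G"
    using assms(4) len by (auto simp: arc_pattern_def list_eq_iff_nth_eq[where xs = "map _ _"])
  then show ?thesis
    using assms(1-3) unfolding partial_iso_def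
    by (auto simp: nth_Cons split: nat.split)
qed

definition induced :: "'v pair_pre_digraph \<Rightarrow> 'v set \<Rightarrow> 'v pair_pre_digraph" where
  "induced G C = \<lparr>pverts = C, parcs = parcs G \<inter> C \<times> C\<rparr>"

lemma induced_simps [simp]:
  "pverts (induced G C) = C" "parcs (induced G C) = parcs G \<inter> C \<times> C"
  by (simp_all add: induced_def)

section \<open>Formulas with only one kind of quantifier\<close>

definition only_quantifier :: "quantifier \<Rightarrow> fo_formula \<Rightarrow> bool" where
  "only_quantifier q \<phi> \<longleftrightarrow> (\<forall>qs \<in> nested_quantifiers \<phi>. set qs \<subseteq> {q})"

text \<open>Excludes vacuity: an outermost quantifier is constrained only if some path runs through
  its body.\<close>

lemma nested_quantifiers_nonempty: "nested_quantifiers \<phi> \<noteq> {}"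
  by (induction \<phi>) auto

lemma only_quantifier_simps [simp]:
  "only_quantifier q (Eq x y)"
  "only_quantifier q (Arc x y)"
  "only_quantifier q (Neg \<phi>) \<longleftrightarrow> only_quantifier q \<phi>"
  "only_quantifier q (Conj \<phi> \<psi>) \<longleftrightarrow> only_quantifier q \<phi> \<and> only_quantifier q \<psi>"
  "only_quantifier q (Disj \<phi> \<psi>) \<longleftrightarrow> only_quantifier q \<phi> \<and> only_quantifier q \<psi>"
  "only_quantifier q (All x \<phi>) \<longleftrightarrow> q = Forall \<and> only_quantifier q \<phi>"
  "only_quantifier q (Ex x \<phi>) \<longleftrightarrow> q = Exists \<and> only_quantifier q \<phi>"
  using nested_quantifiers_nonempty[of \<phi>] by (auto simp: only_quantifier_def)

lemma negations_at_atoms_NegE: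
  assumes "negations_at_atoms (Neg \<phi>)"
  obtains x y where "\<phi> = Eq x y" | x y where "\<phi> = Arc x y"
  using assms by (cases \<phi>) auto

text \<open>The tuple \<open>us\<close> collects the distinct vertices chosen in \<open>G\<close>,
  and \<open>ws\<close> their answers inside \<open>C\<close>; every free variable refers to a
  common position of both. Each existential choice extends this position by one move.\<close>

lemma sat_existential_induced:
  assumes fin: "finite (pverts G)"
  shows "\<lbrakk>negations_at_atoms \<phi>; only_quantifier Exists \<phi>; quantifier_depth \<phi> \<le> k;
    partial_iso G us ws; ext_types G k us = ext_types G k ws; witnesses G k ws C; set ws \<subseteq> C;
    \<forall>x \<in> free_vars \<phi>. \<exists>i < length us. e x = us ! i \<and> e' x = ws ! i; sat G e \<phi>\<rbrakk>
    \<Longrightarrow> sat (induced G C) e' \<phi>"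
proof (induction \<phi> arbitrary: k us ws e e')
  case (Eq x y)
  then show ?case by (auto simp: partial_iso_def nth_eq_iff_index_eq)
next
  case (Arc x y)
  then obtain i j where "i < length us" "e x = us ! i" "e' x = ws ! i"
    "j < length us" "e y = us ! j" "e' y = ws ! j" by auto
  with Arc show ?case by (auto simp: partial_iso_def)
next
  case (Neg \<phi>)
  from Neg.prems(1) show ?case
  proof (cases rule: negations_at_atoms_NegE)
    case (1 x y)
    then show ?thesis using Neg.prems by (auto simp: partial_iso_def nth_eq_iff_index_eq)
  next
    case (2 x y)
    then obtain i j where "i < length us" "e x = us ! i" "e' x = ws ! i"
      "j < length us" "e y = us ! j" "e' y = ws ! j" using Neg.prems(8) by auto
    with 2 Neg.prems show ?thesis by (auto simp: partial_iso_def)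
  qed
next
  case (Conj \<phi> \<psi>)
  from Conj.prems have "sat (induced G C) e' \<phi>" "sat (induced G C) e' \<psi>"
    by (auto intro!: Conj.IH(1)[of k us ws e e'] Conj.IH(2)[of k us ws e e'])
  then show ?case by simp
next
  case (Disj \<phi> \<psi>)
  show ?case
  proof (cases "sat G e \<phi>")
    case True
    with Disj.prems have "sat (induced G C) e' \<phi>" by (auto intro!: Disj.IH(1)[of k us ws e e'])
    then show ?thesis by simp
  next
    case False
    with Disj.prems have "sat (induced G C) e' \<psi>" by (auto intro!: Disj.IH(2)[of k us ws e e'])
    then show ?thesis by simp
  qed
next
  case (All x \<phi>)
  then show ?case by simp
next
  case (Ex x \<phi>)
  obtain l where k: "k = Suc l" and depth: "quantifier_depth \<phi> \<le> l"
    using Ex.prems(3) by (cases k) auto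
  have \<phi>: "negations_at_atoms \<phi>" "only_quantifier Exists \<phi>" using Ex.prems(1,2) by auto
  obtain v where v: "v \<in> pverts G" "sat G (e(x := v)) \<phi>" using Ex.prems(9) by auto
  have len: "length us = length ws" using Ex.prems(4) by (simp add: partial_iso_def)
  show ?case
  \<comment> \<open>An old vertex is answered by its partner in \<open>ws\<close>: the tuples stay
    and only the remaining depth falls.\<close>
  proof (cases "v \<in> set us")
    case True
    then obtain i where i: "i < length us" "v = us ! i" by (metis in_set_conv_nth)
    have "sat (induced G C) (e'(x := ws ! i)) \<phi>"
    proof (rule Ex.IH[OF \<phi> depth Ex.prems(4) _ _ Ex.prems(7) _ v(2)])
      show "ext_types G l us = ext_types G l ws"
        using Ex.prems(5) unfolding k by (rule ext_types_eq_mono[OF fin])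
      show "witnesses G l ws C"
        using Ex.prems(6) unfolding k by (rule witnesses_depth_mono[OF fin])
      show "\<forall>y \<in> free_vars \<phi>. \<exists>j < length us.
          (e(x := v)) y = us ! j \<and> (e'(x := ws ! i)) y = ws ! j"
        using Ex.prems(8) i by auto
    qed
    moreover have "ws ! i \<in> C" using Ex.prems(7) i len by auto
    ultimately show ?thesis by auto
  next
    case False
    with v(1) have "v \<in> pverts G - set us" by blast
    \<comment> \<open>A new vertex is answered in two stages: equality of types gives
      \<open>w\<close> in \<open>G\<close>, and the witness property replaces it by
      \<open>w'\<close> in \<open>C\<close> of the same type over \<open>ws\<close>.\<close>
    from ext_types_SucE[OF fin Ex.prems(5)[unfolded k] this]
    obtain w where w: "w \<in> pverts G - set ws" "arc_pattern G us v = arc_pattern G ws w"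
      "ext_types G l (v # us) = ext_types G l (w # ws)" .
    with Ex.prems(6)[unfolded k] obtain w' where w': "w' \<in> C - set ws"
      "arc_pattern G ws w = arc_pattern G ws w'" "ext_types G l (w # ws) = ext_types G l (w' # ws)"
      "witnesses G l (w' # ws) C"
      unfolding witnesses.simps by blast
    have "sat (induced G C) (e'(x := w')) \<phi>"
    proof (rule Ex.IH[OF \<phi> depth _ _ w'(4) _ _ v(2)])
      show "partial_iso G (v # us) (w' # ws)"
        using Ex.prems(4) False w w' by (intro partial_iso_Cons) auto
      show "ext_types G l (v # us) = ext_types G l (w' # ws)" using w(3) w'(3) by simp
      show "set (w' # ws) \<subseteq> C" using w'(1) Ex.prems(7) by auto
      show "\<forall>y \<in> free_vars \<phi>. \<exists>j < length (v # us).
          (e(x := v)) y = (v # us) ! j \<and> (e'(x := w')) y = (w' # ws) ! j"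
      proof
        fix y assume y: "y \<in> free_vars \<phi>"
        show "\<exists>j < length (v # us).
          (e(x := v)) y = (v # us) ! j \<and> (e'(x := w')) y = (w' # ws) ! j"
        proof (cases "y = x")
          case True
          then show ?thesis by (intro exI[of _ 0]) simp
        next
          case False
          with y Ex.prems(8) obtain i where "i < length us" "e y = us ! i" "e' y = ws ! i" by auto
          with False show ?thesis by (intro exI[of _ "Suc i"]) simp
        qed
      qed
    qed
    then show ?thesis using w'(1) by auto
  qed
qed

text \<open>Every choice in \<open>C\<close> is already a choice in \<open>G\<close>, and literals
  about vertices of \<open>C\<close> keep their truth value.\<close>

lemma sat_universal_induced:
  assumes "C \<subseteq> pverts G"
  shows "\<lbrakk>negations_at_atoms \<phi>; only_quantifier Forall \<phi>;
    \<forall>x \<in> free_vars \<phi>. e x = e' x \<and> e x \<in> C; sat G e \<phi>\<rbrakk> \<Longrightarrow> sat (induced G C) e' \<phi>"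
proof (induction \<phi> arbitrary: e e')
  case (Neg \<phi>)
  from Neg.prems(1) show ?case
    by (cases rule: negations_at_atoms_NegE) (use Neg.prems in auto)
next
  case (Conj \<phi> \<psi>)
  from Conj.prems have "sat (induced G C) e' \<phi>" "sat (induced G C) e' \<psi>"
    by (auto intro!: Conj.IH(1)[of e e'] Conj.IH(2)[of e e'])
  then show ?case by simp
next
  case (Disj \<phi> \<psi>)
  show ?case
  proof (cases "sat G e \<phi>")
    case True
    with Disj.prems have "sat (induced G C) e' \<phi>" by (auto intro!: Disj.IH(1)[of e e'])
    then show ?thesis by simp
  next
    case False
    with Disj.prems have "sat (induced G C) e' \<psi>" by (auto intro!: Disj.IH(2)[of e e'])
    then show ?thesis by simp
  qed
next
  case (All x \<phi>)
  have "sat (induced G C) (e'(x := v)) \<phi>" if "v \<in> C" for v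
  proof (rule All.IH)
    show "sat G (e(x := v)) \<phi>" using All.prems(4) that assms by auto
    show "\<forall>y \<in> free_vars \<phi>. (e(x := v)) y = (e'(x := v)) y \<and> (e(x := v)) y \<in> C"
      using All.prems(3) that by (metis DiffI fun_upd_apply free_vars.simps(6) singletonD)
  qed (use All.prems(1,2) in auto)
  then show ?case by simp
qed auto

text \<open>The relation \<open>sublist\<close> concerns contiguous segments, so only neighbours are
  compared; their equality propagates along the list.\<close>

lemma non_alternating_Cons:
  assumes "\<not> sublist [Forall, Exists] (q # qs)" and "\<not> sublist [Exists, Forall] (q # qs)"
  shows "set qs \<subseteq> {q}"
  using assms
proof (induction qs arbitrary: q)
  case (Cons p qs)
  have "p = q"
    using Cons.prems by (cases p; cases q) (auto simp: sublist_Cons_right)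
  moreover have "set qs \<subseteq> {p}"
    using Cons.prems by (intro Cons.IH) (auto simp: sublist_Cons_right[of _ q])
  ultimately show ?case by simp
qed simp

text \<open>All paths begin with the outermost quantifier, which therefore fixes every quantifier
  below it.\<close>

lemma zero_alternating_quantified:
  assumes "zero_alternating \<phi>"
  shows "\<phi> = All x \<psi> \<Longrightarrow> only_quantifier Forall \<phi>" and "\<phi> = Ex x \<psi> \<Longrightarrow> only_quantifier Exists \<phi>"
  using assms non_alternating_Cons
  by (fastforce simp: zero_alternating_def only_quantifier_def)+

lemma sat_zero_alternating_induced:
  assumes fin: "finite (pverts G)" and C: "C \<subseteq> pverts G"
  shows "\<lbrakk>zero_alternating \<phi>; sentence \<phi>; witnesses G (quantifier_depth \<phi>) [] C; sat G e \<phi>\<rbrakk>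
    \<Longrightarrow> sat (induced G C) e' \<phi>"
proof -
  \<comment> \<open>The depth is relaxed to a common \<open>k\<close>, so that both parts of a
    conjunction or disjunction can use the same \<open>C\<close>.\<close>
  have "sat (induced G C) e' \<phi>"
    if "zero_alternating \<phi>" "sentence \<phi>" "witnesses G k [] C" "quantifier_depth \<phi> \<le> k" "sat G e \<phi>"
    for k
    using that
  proof (induction \<phi>)
    \<comment> \<open>A negated atom has free variables and is no sentence; the plain atoms are
      excluded in the same way.\<close>
    case (Neg \<phi>)
    then have "negations_at_atoms (Neg \<phi>)" by (simp add: zero_alternating_def)
    then show ?case
      by (cases rule: negations_at_atoms_NegE) (use Neg.prems in \<open>auto simp: sentence_def\<close>)
  next
    case (All x \<phi>)
    show ?case
      using All.prems zero_alternating_quantified(1)[OF All.prems(1) refl]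
      by (intro sat_universal_induced[OF C, where e = e])
        (auto simp: sentence_def zero_alternating_def simp del: sat.simps)
  next
    case (Ex x \<phi>)
    show ?case
      using Ex.prems zero_alternating_quantified(2)[OF Ex.prems(1) refl]
      by (intro sat_existential_induced[OF fin, where e = e and k = k and us = "[]" and ws = "[]"])
        (auto simp: sentence_def zero_alternating_def partial_iso_def simp del: sat.simps)
  qed (auto simp: sentence_def zero_alternating_def)
  then show "\<lbrakk>zero_alternating \<phi>; sentence \<phi>; witnesses G (quantifier_depth \<phi>) [] C; sat G e \<phi>\<rbrakk>
    \<Longrightarrow> sat (induced G C) e' \<phi>" by blast
qed

section \<open>Transport to digraphs on natural numbers and the size bound\<close>

definition relabel :: "('v \<Rightarrow> 'w) \<Rightarrow> 'v pair_pre_digraph \<Rightarrow> 'w pair_pre_digraph" where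
  "relabel f G = \<lparr>pverts = f ` pverts G, parcs = map_prod f f ` parcs G\<rparr>"

lemma relabel_simps [simp]:
  "pverts (relabel f G) = f ` pverts G" "parcs (relabel f G) = map_prod f f ` parcs G"
  by (simp_all add: relabel_def)

text \<open>Needed because \<open>defines_digraph\<close> compares only with digraphs on
  \<open>nat\<close>, whereas the induced subgraph has vertices of type \<open>'v\<close>.\<close>

lemma sat_relabel:
  assumes "pair_wf_digraph G" and inj: "inj_on f (pverts G)"
  shows "\<forall>x \<in> free_vars \<phi>. e x \<in> pverts G \<and> e' x = f (e x) \<Longrightarrow>
    sat (relabel f G) e' \<phi> \<longleftrightarrow> sat G e \<phi>"
proof (induction \<phi> arbitrary: e e')
  case (Eq x y)
  then show ?case using inj by (auto simp: inj_on_eq_iff)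
next
  case (Arc x y)
  \<comment> \<open>Arcs are reflected as well: the ends of \<open>(a, b)\<close> are vertices by
    well-formedness, so injectivity identifies them with \<open>u\<close> and
    \<open>v\<close>.\<close>
  have "(u, v) \<in> parcs G"
    if "(a, b) \<in> parcs G" "f u = f a" "f v = f b" "u \<in> pverts G" "v \<in> pverts G" for a b u v
    using that pair_wf_digraph.in_arcsD1[OF assms(1)] pair_wf_digraph.in_arcsD2[OF assms(1)]
      inj_onD[OF inj] by metis
  with Arc show ?case by (auto intro: image_eqI[where x = "(e x, e y)"])
next
  case (All x \<phi>)
  have "sat (relabel f G) (e'(x := f v)) \<phi> \<longleftrightarrow> sat G (e(x := v)) \<phi>" if "v \<in> pverts G" for v
    using All.prems that by (intro All.IH) auto
  then show ?case by simp
next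
  case (Ex x \<phi>)
  have "sat (relabel f G) (e'(x := f v)) \<phi> \<longleftrightarrow> sat G (e(x := v)) \<phi>" if "v \<in> pverts G" for v
    using Ex.prems that by (intro Ex.IH) auto
  then show ?case by simp
next
  case (Neg \<phi>)
  from Neg.IH[of e e'] Neg.prems show ?case by simp
next
  case (Conj \<phi> \<psi>)
  from Conj.IH(1)[of e e'] Conj.IH(2)[of e e'] Conj.prems show ?case by simp
next
  case (Disj \<phi> \<psi>)
  from Disj.IH(1)[of e e'] Disj.IH(2)[of e e'] Disj.prems show ?case by simp
qed

lemma digraph_iso_card:
  assumes "digraph_iso (with_proj G) (with_proj H)"
  shows "card (pverts G) = card (pverts H)"
proof -
  obtain h where h: "pre_digraph.digraph_isomorphism (with_proj G) h"
    "with_proj H = app_iso h (with_proj G)"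
    using assms by (auto simp: digraph_iso_def)
  have "pverts H = iso_verts h ` pverts G" using arg_cong[OF h(2), of verts] by simp
  moreover have "inj_on (iso_verts h) (pverts G)"
    using h(1) by (simp add: pre_digraph.digraph_isomorphism_def)
  ultimately show ?thesis by (simp add: card_image)
qed

text \<open>Every atom mentions a variable, which only a quantifier can bind.\<close>

lemma quantifier_depth_pos: "sentence \<phi> \<Longrightarrow> quantifier_depth \<phi> > 0"
  unfolding sentence_def by (induction \<phi>) auto

lemma card_le_witness_bound:
  fixes G :: "'v pair_pre_digraph"
  assumes G: "nonempty_fin_digraph G" and \<phi>: "zero_alternating \<phi>" "defines_digraph \<phi> G"
  shows "card (pverts G) \<le> witness_bound (quantifier_depth \<phi>) 0"
proof -
  let ?d = "quantifier_depth \<phi>"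
  have fin: "finite (pverts G)" and ne: "pverts G \<noteq> {}"
    using G by (auto simp: nonempty_fin_digraph_def pair_fin_digraph_def pair_fin_digraph_axioms_def)
  have sent: "sentence \<phi>" and true: "true_on \<phi> G" using \<phi>(2) by (auto simp: defines_digraph_def)
  obtain C where C: "C \<subseteq> pverts G" "witnesses G ?d [] C" "card C \<le> witness_bound ?d 0"
    using ex_small_witnesses[OF fin, of ?d "[]"] by auto
  have finC: "finite C" using C(1) fin finite_subset by blast
  \<comment> \<open>Positive depth forces at least one representative, so the subgraph is a
    legitimate competitor of \<open>G\<close>.\<close>
  have "C \<noteq> {}"
    using C(2) quantifier_depth_pos[OF sent] ne by (cases ?d) auto
  obtain f :: "'v \<Rightarrow> nat" where f: "inj_on f C" using finite_imp_inj_to_nat_seg[OF finC] by blast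
  let ?H = "relabel f (induced G C)"
  have wfC: "pair_wf_digraph (induced G C)" by unfold_locales auto
  have "sat (induced G C) e \<phi>" for e
    using sat_zero_alternating_induced[OF fin C(1) \<phi>(1) sent C(2)] true by (auto simp: true_on_def)
  then have "true_on \<phi> ?H"
    using sat_relabel[OF wfC, of f \<phi>] f sent by (auto simp: true_on_def sentence_def)
  moreover have "nonempty_fin_digraph ?H"
  proof -
    have "finite (parcs G \<inter> C \<times> C)" using finC by blast
    then have "pair_fin_digraph ?H" using finC by unfold_locales auto
    then show ?thesis using \<open>C \<noteq> {}\<close> by (simp add: nonempty_fin_digraph_def)
  qed
  ultimately have "digraph_iso (with_proj G) (with_proj ?H)"
    using \<phi>(2) by (auto simp: defines_digraph_def)
  then have "card (pverts G) = card (f ` C)" using digraph_iso_card by fastforce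
  also have "\<dots> = card C" using f by (rule card_image)
  finally show ?thesis using C(3) by simp
qed

section \<open>Every digraph has a 0-alternating definition\<close>

lemma sat_foldr_Ex:
  "sat G e (foldr Ex xs \<phi>) \<longleftrightarrow> (\<exists>e'. (\<forall>x \<in> set xs. e' x \<in> pverts G) \<and>
     (\<forall>x. x \<notin> set xs \<longrightarrow> e' x = e x) \<and> sat G e' \<phi>)"
proof (induction xs arbitrary: e)
  case Nil
  have "e' = e" if "\<forall>x. e' x = e x" for e' using that by blast
  then show ?case by auto
next
  case (Cons y xs)
  show ?case (is "?L \<longleftrightarrow> ?R")
  proof
    assume ?L
    then obtain v e' where *: "v \<in> pverts G" "\<forall>x \<in> set xs. e' x \<in> pverts G"
      "\<forall>x. x \<notin> set xs \<longrightarrow> e' x = (e(y := v)) x" "sat G e' \<phi>"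
      using Cons.IH by auto
    \<comment> \<open>If \<open>y\<close> is quantified again within \<open>xs\<close>, the inner
      value overrides \<open>v\<close>; both are vertices.\<close>
    moreover have "e' y \<in> pverts G" using *(1-3) by (cases "y \<in> set xs") auto
    ultimately show ?R by (intro exI[of _ e']) auto
  next
    assume ?R
    then obtain e' where *: "\<forall>x \<in> set (y # xs). e' x \<in> pverts G"
      "\<forall>x. x \<notin> set (y # xs) \<longrightarrow> e' x = e x" "sat G e' \<phi>" by blast
    then have "sat G (e(y := e' y)) (foldr Ex xs \<phi>)"
      unfolding Cons.IH by (intro exI[of _ e']) auto
    then show ?L using *(1) by auto
  qed
qed

lemma sat_foldr_All:
  "sat G e (foldr All xs \<phi>) \<longleftrightarrow> (\<forall>e'. (\<forall>x \<in> set xs. e' x \<in> pverts G) \<longrightarrow>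
     (\<forall>x. x \<notin> set xs \<longrightarrow> e' x = e x) \<longrightarrow> sat G e' \<phi>)"
proof -
  have "sat G e (foldr All xs \<phi>) \<longleftrightarrow> \<not> sat G e (foldr Ex xs (Neg \<phi>))" for e
    by (induction xs arbitrary: e) auto
  then show ?thesis unfolding sat_foldr_Ex by auto
qed

lemma free_vars_foldr_quantifier:
  "free_vars (foldr Ex xs \<phi>) = free_vars \<phi> - set xs"
  "free_vars (foldr All xs \<phi>) = free_vars \<phi> - set xs"
  by (induction xs) auto

lemma negations_at_atoms_foldr_quantifier:
  "negations_at_atoms (foldr Ex xs \<phi>) = negations_at_atoms \<phi>"
  "negations_at_atoms (foldr All xs \<phi>) = negations_at_atoms \<phi>"
  by (induction xs) auto

lemma only_quantifier_foldr:
  "only_quantifier Exists \<phi> \<Longrightarrow> only_quantifier Exists (foldr Ex xs \<phi>)"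
  "only_quantifier Forall \<phi> \<Longrightarrow> only_quantifier Forall (foldr All xs \<phi>)"
  by (induction xs) auto

text \<open>There are no constants for truth and falsity, hence the tautology and the contradiction
  about the variable 0 as neutral elements.\<close>

definition conj_list :: "fo_formula list \<Rightarrow> fo_formula" where
  "conj_list \<phi>s = foldr Conj \<phi>s (Eq 0 0)"

definition disj_list :: "fo_formula list \<Rightarrow> fo_formula" where
  "disj_list \<phi>s = foldr Disj \<phi>s (Neg (Eq 0 0))"

lemma conj_list_simps [simp]:
  "sat G e (conj_list \<phi>s) \<longleftrightarrow> (\<forall>\<phi> \<in> set \<phi>s. sat G e \<phi>)"
  "free_vars (conj_list \<phi>s) = insert 0 (\<Union>\<phi> \<in> set \<phi>s. free_vars \<phi>)"
  "negations_at_atoms (conj_list \<phi>s) \<longleftrightarrow> (\<forall>\<phi> \<in> set \<phi>s. negations_at_atoms \<phi>)"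
  "only_quantifier q (conj_list \<phi>s) \<longleftrightarrow> (\<forall>\<phi> \<in> set \<phi>s. only_quantifier q \<phi>)"
  by (induction \<phi>s) (auto simp: conj_list_def)

lemma disj_list_simps [simp]:
  "sat G e (disj_list \<phi>s) \<longleftrightarrow> (\<exists>\<phi> \<in> set \<phi>s. sat G e \<phi>)"
  "free_vars (disj_list \<phi>s) = insert 0 (\<Union>\<phi> \<in> set \<phi>s. free_vars \<phi>)"
  "negations_at_atoms (disj_list \<phi>s) \<longleftrightarrow> (\<forall>\<phi> \<in> set \<phi>s. negations_at_atoms \<phi>)"
  "only_quantifier q (disj_list \<phi>s) \<longleftrightarrow> (\<forall>\<phi> \<in> set \<phi>s. only_quantifier q \<phi>)"
  by (induction \<phi>s) (auto simp: disj_list_def)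

definition arc_literal :: "'v pair_pre_digraph \<Rightarrow> 'v list \<Rightarrow> nat \<Rightarrow> nat \<Rightarrow> fo_formula" where
  "arc_literal G vs i j = (if (vs ! i, vs ! j) \<in> parcs G then Arc i j else Neg (Arc i j))"

definition eq_literal :: "nat \<Rightarrow> nat \<Rightarrow> fo_formula" where
  "eq_literal i j = (if i = j then Eq i j else Neg (Eq i j))"

text \<open>Variable \<open>i\<close> stands for \<open>vs ! i\<close>. Non-arcs are recorded too,
  so the embedding is onto an induced subgraph.\<close>

definition embedding_sentence :: "'v pair_pre_digraph \<Rightarrow> 'v list \<Rightarrow> fo_formula" where
  "embedding_sentence G vs = foldr Ex [0..<length vs] (conj_list
     [Conj (eq_literal i j) (arc_literal G vs i j). i \<leftarrow> [0..<length vs], j \<leftarrow> [0..<length vs]])"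

text \<open>Pigeonhole form: any \<open>n + 1\<close> choices of vertices contain a repetition. It
  is purely universal, so its conjunction with the existential embedding sentence is
  0-alternating.\<close>

definition at_most_sentence :: "nat \<Rightarrow> fo_formula" where
  "at_most_sentence n = foldr All [0..<Suc n] (disj_list [Eq i j. i \<leftarrow> [0..<Suc n], j \<leftarrow> [0..<i]])"

lemma sat_embedding_sentence:
  "sat H e (embedding_sentence G vs) \<longleftrightarrow> (\<exists>g. inj_on g {..<length vs} \<and> g ` {..<length vs} \<subseteq> pverts H \<and>
     (\<forall>i < length vs. \<forall>j < length vs. (g i, g j) \<in> parcs H \<longleftrightarrow> (vs ! i, vs ! j) \<in> parcs G))"
  (is "?L \<longleftrightarrow> (\<exists>g. ?P g)")
proof
  assume ?L
  then obtain g where g: "\<forall>i < length vs. g i \<in> pverts H"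
    "\<And>i j. i < length vs \<Longrightarrow> j < length vs \<Longrightarrow> sat H g (eq_literal i j) \<and> sat H g (arc_literal G vs i j)"
    unfolding embedding_sentence_def sat_foldr_Ex by fastforce
  have "?P g"
  proof (intro conjI inj_onI allI impI)
    show "i = j" if "i \<in> {..<length vs}" "j \<in> {..<length vs}" "g i = g j" for i j
      using g(2)[of i j] that by (auto simp: eq_literal_def split: if_splits)
    show "g ` {..<length vs} \<subseteq> pverts H" using g(1) by auto
    show "(g i, g j) \<in> parcs H \<longleftrightarrow> (vs ! i, vs ! j) \<in> parcs G" if "i < length vs" "j < length vs" for i j
      using g(2)[OF that] by (auto simp: arc_literal_def split: if_splits)
  qed
  then show "\<exists>g. ?P g" by (rule exI[of _ g])
next
  assume "\<exists>g. ?P g"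
  then obtain g where g: "?P g" by blast
  let ?e = "\<lambda>i. if i < length vs then g i else e i"
  show ?L
    unfolding embedding_sentence_def sat_foldr_Ex
    by (rule exI[of _ ?e])
      (use g in \<open>auto simp: eq_literal_def arc_literal_def inj_on_def image_subset_iff\<close>)
qed

lemma sat_at_most_sentence:
  assumes "finite (pverts H)"
  shows "sat H e (at_most_sentence n) \<longleftrightarrow> card (pverts H) \<le> n"
proof
  assume sat: "sat H e (at_most_sentence n)"
  show "card (pverts H) \<le> n"
  proof (rule ccontr)
    assume "\<not> card (pverts H) \<le> n"
    then have "card {..n} \<le> card (pverts H)" by simp
    then obtain g where g: "inj_on g {..n}" "g ` {..n} \<subseteq> pverts H"
      using card_le_inj[OF finite_atMost assms] by blast
    let ?e = "\<lambda>i. if i \<le> n then g i else e i"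
    have "sat H ?e (disj_list [Eq i j. i \<leftarrow> [0..<Suc n], j \<leftarrow> [0..<i]])"
      using sat g(2) unfolding at_most_sentence_def sat_foldr_All by (auto simp: image_subset_iff)
    then obtain i j where "i \<le> n" "j < i" "g i = g j" by (fastforce simp: less_Suc_eq_le simp del: upt_Suc)
    with g(1) show False by (auto dest: inj_onD)
  qed
next
  assume le: "card (pverts H) \<le> n"
  show "sat H e (at_most_sentence n)"
    unfolding at_most_sentence_def sat_foldr_All
  proof (intro allI impI)
    fix e' assume "\<forall>x \<in> set [0..<Suc n]. e' x \<in> pverts H"
    then have "e' ` {..n} \<subseteq> pverts H" by auto
    from card_mono[OF assms this] le have "card (e' ` {..n}) < card {..n}" by simp
    then have "\<not> inj_on e' {..n}" by (metis card_image less_irrefl)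
    then obtain i j where "i \<le> n" "j \<le> n" "i \<noteq> j" "e' i = e' j" by (auto simp: inj_on_def)
    then obtain i j where "i \<le> n" "j < i" "e' i = e' j" by (metis linorder_neqE_nat)
    then show "sat H e' (disj_list [Eq i j. i \<leftarrow> [0..<Suc n], j \<leftarrow> [0..<i]])"
      unfolding disj_list_simps
      by (intro bexI[of _ "Eq i j"]) (auto simp: less_Suc_eq_le simp del: upt_Suc intro!: bexI[of _ i])
  qed
qed

lemma zero_alternating_if_only_quantifier:
  assumes "negations_at_atoms \<phi>" and "only_quantifier q \<phi>"
  shows "zero_alternating \<phi>"
  unfolding zero_alternating_def
proof (intro conjI ballI notI)
  show "negations_at_atoms \<phi>" by fact
  show False if "qs \<in> nested_quantifiers \<phi>" "sublist [Forall, Exists] qs" for qs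
    using set_mono_sublist[OF that(2)] that(1) assms(2)
    by (cases q) (auto simp: only_quantifier_def)
  show False if "qs \<in> nested_quantifiers \<phi>" "sublist [Exists, Forall] qs" for qs
    using set_mono_sublist[OF that(2)] that(1) assms(2)
    by (cases q) (auto simp: only_quantifier_def)
qed

lemma zero_alternating_Conj:
  "zero_alternating \<phi> \<Longrightarrow> zero_alternating \<psi> \<Longrightarrow> zero_alternating (Conj \<phi> \<psi>)"
  by (auto simp: zero_alternating_def)

lemma digraph_isoI:
  assumes "pair_wf_digraph G" and "inj_on f (pverts G)"
    and "pverts H = f ` pverts G" and "parcs H = map_prod f f ` parcs G"
  shows "digraph_iso (with_proj G) (with_proj H)"
proof -
  \<comment> \<open>Arcs of \<open>with_proj\<close> are pairs with \<open>fst\<close> as tail and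
    \<open>snd\<close> as head, so the vertex map determines the arc map.\<close>
  let ?h = "\<lparr>iso_verts = f, iso_arcs = map_prod f f, iso_head = snd, iso_tail = fst\<rparr>"
  have "parcs G \<subseteq> pverts G \<times> pverts G"
    using pair_wf_digraph.in_arcsD1[OF assms(1)] pair_wf_digraph.in_arcsD2[OF assms(1)] by auto
  then have "inj_on (map_prod f f) (parcs G)"
    using map_prod_inj_on[OF assms(2) assms(2)] inj_on_subset by blast
  then have "pre_digraph.digraph_isomorphism (with_proj G) ?h"
    using assms(1,2) by (auto simp: pre_digraph.digraph_isomorphism_def wf_digraph_wp_iff)
  moreover have "with_proj H = app_iso ?h (with_proj G)"
    using assms(3,4) by (simp add: with_proj_def app_iso_def)
  ultimately show ?thesis by (auto simp: digraph_iso_def)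
qed

text \<open>Without such a sentence the least depth \<^term>\<open>D0 G\<close> would be an arbitrary number.\<close>

lemma ex_zero_alternating_definition:
  fixes G :: "'v pair_pre_digraph"
  assumes G: "nonempty_fin_digraph G"
  shows "\<exists>\<phi>. zero_alternating \<phi> \<and> defines_digraph \<phi> G"
proof -
  have wf: "pair_wf_digraph G" and fin: "finite (pverts G)" and ne: "pverts G \<noteq> {}"
    using G by (auto simp: nonempty_fin_digraph_def pair_fin_digraph_def pair_fin_digraph_axioms_def)
  obtain vs where vs: "set vs = pverts G" "distinct vs" using finite_distinct_list[OF fin] by blast
  let ?n = "length vs"
  have n: "card (pverts G) = ?n" "?n > 0" using vs ne distinct_card by fastforce+
  have inj_nth: "inj_on ((!) vs) {..<?n}" by (rule inj_on_nth[OF vs(2)]) simp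
  have verts: "pverts G = (!) vs ` {..<?n}" unfolding vs(1)[symmetric] by (auto simp: set_conv_nth)
  let ?\<phi> = "Conj (embedding_sentence G vs) (at_most_sentence ?n)"
  have "zero_alternating (embedding_sentence G vs)"
    by (rule zero_alternating_if_only_quantifier[of _ Exists])
      (auto simp: embedding_sentence_def negations_at_atoms_foldr_quantifier eq_literal_def
        arc_literal_def intro!: only_quantifier_foldr)
  moreover have "zero_alternating (at_most_sentence ?n)"
    by (rule zero_alternating_if_only_quantifier[of _ Forall])
      (auto simp: at_most_sentence_def negations_at_atoms_foldr_quantifier
        simp del: upt_Suc intro!: only_quantifier_foldr)
  ultimately have "zero_alternating ?\<phi>" by (rule zero_alternating_Conj)
  moreover have "sentence ?\<phi>"
    using n(2) by (auto simp: sentence_def embedding_sentence_def at_most_sentence_def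
        free_vars_foldr_quantifier eq_literal_def arc_literal_def simp del: upt_Suc split: if_splits)
  moreover have "true_on ?\<phi> G"
  proof -
    have "\<exists>g. inj_on g {..<?n} \<and> g ` {..<?n} \<subseteq> pverts G \<and>
        (\<forall>i < ?n. \<forall>j < ?n. (g i, g j) \<in> parcs G \<longleftrightarrow> (vs ! i, vs ! j) \<in> parcs G)"
      by (rule exI[of _ "(!) vs"]) (use inj_nth verts in simp)
    then show ?thesis
      by (simp add: true_on_def sat_embedding_sentence sat_at_most_sentence[OF fin] n(1))
  qed
  moreover have "digraph_iso (with_proj G) (with_proj H)"
    if H: "nonempty_fin_digraph H" and true: "true_on ?\<phi> H" for H :: "nat pair_pre_digraph"
  proof -
    have wfH: "pair_wf_digraph H" and finH: "finite (pverts H)"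
      using H by (auto simp: nonempty_fin_digraph_def pair_fin_digraph_def pair_fin_digraph_axioms_def)
    from true have card: "card (pverts H) \<le> ?n"
      and "\<exists>g. inj_on g {..<?n} \<and> g ` {..<?n} \<subseteq> pverts H \<and>
        (\<forall>i < ?n. \<forall>j < ?n. (g i, g j) \<in> parcs H \<longleftrightarrow> (vs ! i, vs ! j) \<in> parcs G)"
      by (simp_all add: true_on_def sat_embedding_sentence sat_at_most_sentence[OF finH])
    then obtain g where g: "inj_on g {..<?n}" "g ` {..<?n} \<subseteq> pverts H"
      "\<And>i j. i < ?n \<Longrightarrow> j < ?n \<Longrightarrow> (g i, g j) \<in> parcs H \<longleftrightarrow> (vs ! i, vs ! j) \<in> parcs G"
      by blast
    \<comment> \<open>The universal half bounds the size of \<open>H\<close>, which turns the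
      embedding into a bijection on vertices.\<close>
    have surj: "g ` {..<?n} = pverts H"
      using card_image[OF g(1)] card g(2) finH by (intro card_seteq) auto
    \<comment> \<open>The map \<open>g\<close> acts on indices; the inverse of the enumeration
      \<open>vs\<close> turns it into a map on vertices.\<close>
    define f where "f = g \<circ> the_inv_into {..<?n} ((!) vs)"
    have f: "f (vs ! i) = g i" if "i < ?n" for i
      using that the_inv_into_f_f[OF inj_nth, of i] by (simp add: f_def)
    show ?thesis
    proof (rule digraph_isoI[OF wf, of f])
      show "inj_on f (pverts G)"
        unfolding verts using f g(1) by (auto simp: inj_on_def)
      show "pverts H = f ` pverts G"
        unfolding verts image_image surj[symmetric] using f by auto
      show "parcs H = map_prod f f ` parcs G"
      proof (intro set_eqI iffI)
        fix a assume a: "a \<in> parcs H"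
        have "fst a \<in> g ` {..<?n}" "snd a \<in> g ` {..<?n}"
          unfolding surj using a wfH pair_wf_digraph.arc_fst_in_verts pair_wf_digraph.arc_snd_in_verts
          by blast+
        then obtain i j where ij: "i < ?n" "j < ?n" "a = (g i, g j)" by (cases a) auto
        then have "(vs ! i, vs ! j) \<in> parcs G" using a g(3) by blast
        then show "a \<in> map_prod f f ` parcs G"
          using ij f by (intro image_eqI[of _ _ "(vs ! i, vs ! j)"]) auto
      next
        fix a assume "a \<in> map_prod f f ` parcs G"
        then obtain u v where uv: "(u, v) \<in> parcs G" "a = (f u, f v)" by auto
        then have "u \<in> pverts G" "v \<in> pverts G"
          using pair_wf_digraph.in_arcsD1[OF wf] pair_wf_digraph.in_arcsD2[OF wf] by auto
        then obtain i j where "i < ?n" "j < ?n" "u = vs ! i" "v = vs ! j" unfolding verts by auto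
        then show "a \<in> parcs H" using uv f g(3) by auto
      qed
    qed
  qed
  ultimately show ?thesis by (auto simp: defines_digraph_def)
qed

section \<open>The lower bound\<close>

theorem theorem2:
  fixes n :: nat and G :: "'v pair_pre_digraph"
  assumes "n \<ge> 1" and "nonempty_fin_digraph G" and "card (pverts G) = n"
  shows "int (D0 G) \<ge> int (log_star (real n)) - int (log_star (real (log_star (real n)))) - 1"
proof -
  let ?h = "log_star (real n)"
  let ?Q = "\<lambda>d. \<exists>\<phi>. zero_alternating \<phi> \<and> defines_digraph \<phi> G \<and> quantifier_depth \<phi> = d"
  have "\<exists>d. ?Q d" using ex_zero_alternating_definition[OF assms(2)] by blast
  then have "?Q (D0 G)" unfolding D0_def by (rule LeastI_ex[of ?Q])
  then obtain \<phi> where \<phi>: "zero_alternating \<phi>" "defines_digraph \<phi> G" "quantifier_depth \<phi> = D0 G"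
    by blast
  have "D0 G \<ge> 1"
    using \<phi>(2,3) quantifier_depth_pos[of \<phi>] by (auto simp: defines_digraph_def)
  then have "n \<le> tower (D0 G + 1 + log_star (real (D0 G)))"
    using card_le_witness_bound[OF assms(2) \<phi>(1,2)] witness_bound_le_tower[of "D0 G"] assms(3) \<phi>(3)
    by simp
  then have h: "?h \<le> D0 G + 1 + log_star (real (D0 G))"
    by (intro log_star_le_if_le_tower) simp
  show ?thesis
  \<comment> \<open>If \<open>D0 G \<le> ?h\<close>, monotonicity replaces
    \<open>log_star (D0 G)\<close> by \<open>log_star ?h\<close> in \<open>h\<close>; otherwise
    \<open>D0 G\<close> exceeds even \<open>?h\<close>.\<close>
  proof (cases "D0 G \<le> ?h")
    case True
    then show ?thesis using h log_star_mono[OF True] by linarith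
  next
    case False
    then show ?thesis by linarith
  qed
qed

end
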